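(* Let $\Phi_1,\Phi_2:\mathbb{C}\to\mathbb{R}$ be two real-valued real-quadratic forms which are strictly plurisubharmonic. Define $$a=\frac{\partial_{\bar z}\partial_z\Phi_2}{\partial_{\bar z}\partial_z\Phi_1},\qquad b=\frac{|\partial_z^2(\Phi_2-\Phi_1)|}{\partial_{\bar z}\partial_z\Phi_1}.$$ Let $\iota: u\mapsto u$ be the embedding from $H_{\Phi_1}$ into $H_{\Phi_2}$, which is bounded if and only if $a-b\ge1$, that is to say, if and only if $\Phi_1\le\Phi_2$ on $\mathbb{C}$. Suppose that $a-b\geq 1$. Then: (1) If $b=0$, then $\|\iota\|=a^{-1/2}$. (2) If $a-b=1$ and $b>0$, then $\|\iota\|=a^{-1/4}$. (3) If $a-b>1$ and $b>0$, then for $$\gamma=\frac{1}{2b}\left(1-a^2+b^2+\sqrt{(a^2-b^2-1)^2-4b^2}\right)$$ one has $$\|\iota\|=\left(\frac{1-\gamma^2}{a^2-(b-\gamma)^2}\right)^{1/4}.$$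
   Context: Real-quadratic means a homogeneous quadratic form in $(\operatorname{Re}z,\operatorname{Im}z)$. Derivatives are the Wirtinger derivatives $\partial_z=\frac12(\partial_{\operatorname{Re}z}-i\partial_{\operatorname{Im}z})$, $\partial_{\bar z}=\frac12(\partial_{\operatorname{Re}z}+i\partial_{\operatorname{Im}z})$; the second derivatives of a quadratic form are constants. Strictly plurisubharmonic means $\partial_{\bar z}\partial_z\Phi=\frac14(\partial_{\operatorname{Re}z}^2+\partial_{\operatorname{Im}z}^2)\Phi>0$. For such a weight $\Phi$, $$H_\Phi=\operatorname{Hol}(\mathbb{C})\cap L^2(\mathbb{C},e^{-2\Phi(z)}\,d\operatorname{Re}z\,d\operatorname{Im}z),\qquad \|u\|_\Phi=\left(\int_{\mathbb{C}}|u(z)|^2e^{-2\Phi(z)}\,d\operatorname{Re}z\,d\operatorname{Im}z\right)^{1/2},$$ where $\operatorname{Hol}(\mathbb{C})$ is the set of entire functions. The embedding $\iota$ is a priori a possibly unbounded operator with domain $H_{\Phi_1}\cap H_{\Phi_2}\subset H_{\Phi_1}$; it is called bounded if it is defined on all of $H_{\Phi_1}$ and bounded into $H_{\Phi_2}$. *)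

theory Defs
  imports "HOL-Analysis.Analysis"
begin

definition real_quadratic :: "(complex \<Rightarrow> real) \<Rightarrow> bool" where
  "real_quadratic \<Phi> \<longleftrightarrow>
     (\<exists>p q r. \<forall>z. \<Phi> z = p * (Re z)\<^sup>2 + q * Re z * Im z + r * (Im z)\<^sup>2)"

definition partial_Re :: "(complex \<Rightarrow> complex) \<Rightarrow> complex \<Rightarrow> complex" where
  "partial_Re f z = vector_derivative (\<lambda>t. f (z + complex_of_real t)) (at 0)"

definition partial_Im :: "(complex \<Rightarrow> complex) \<Rightarrow> complex \<Rightarrow> complex" where
  "partial_Im f z = vector_derivative (\<lambda>t. f (z + \<i> * complex_of_real t)) (at 0)"

definition wirtinger :: "(complex \<Rightarrow> complex) \<Rightarrow> complex \<Rightarrow> complex" where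
  "wirtinger f z = (partial_Re f z - \<i> * partial_Im f z) / 2"

definition wirtinger_bar :: "(complex \<Rightarrow> complex) \<Rightarrow> complex \<Rightarrow> complex" where
  "wirtinger_bar f z = (partial_Re f z + \<i> * partial_Im f z) / 2"

definition holo_hessian :: "(complex \<Rightarrow> real) \<Rightarrow> complex \<Rightarrow> complex" where
  "holo_hessian \<Phi> = wirtinger (wirtinger (\<lambda>z. complex_of_real (\<Phi> z)))"

text \<open>For quadratic forms the mixed derivative is a real number (see the lemma
  \<open>mixed_wirtinger_quadratic\<close> below), so taking its real part only changes the type.\<close>

definition levi :: "(complex \<Rightarrow> real) \<Rightarrow> complex \<Rightarrow> real" where
  "levi \<Phi> z = Re (wirtinger_bar (wirtinger (\<lambda>z. complex_of_real (\<Phi> z))) z)"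

definition strictly_plurisubharmonic :: "(complex \<Rightarrow> real) \<Rightarrow> bool" where
  "strictly_plurisubharmonic \<Phi> \<longleftrightarrow> (\<forall>z. levi \<Phi> z > 0)"

definition H_space :: "(complex \<Rightarrow> real) \<Rightarrow> (complex \<Rightarrow> complex) set" where
  "H_space \<Phi> = {u. u holomorphic_on UNIV \<and>
      integrable lborel (\<lambda>z. (cmod (u z))\<^sup>2 * exp (- 2 * \<Phi> z))}"

definition H_norm :: "(complex \<Rightarrow> real) \<Rightarrow> (complex \<Rightarrow> complex) \<Rightarrow> real" where
  "H_norm \<Phi> u = sqrt (LINT z|lborel. (cmod (u z))\<^sup>2 * exp (- 2 * \<Phi> z))"

definition embedding_domain ::
  "(complex \<Rightarrow> real) \<Rightarrow> (complex \<Rightarrow> real) \<Rightarrow> (complex \<Rightarrow> complex) set" where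
  "embedding_domain \<Phi>1 \<Phi>2 = H_space \<Phi>1 \<inter> H_space \<Phi>2"

definition embedding_bounded :: "(complex \<Rightarrow> real) \<Rightarrow> (complex \<Rightarrow> real) \<Rightarrow> bool" where
  "embedding_bounded \<Phi>1 \<Phi>2 \<longleftrightarrow>
     embedding_domain \<Phi>1 \<Phi>2 = H_space \<Phi>1 \<and>
     (\<exists>C. \<forall>u \<in> H_space \<Phi>1. H_norm \<Phi>2 u \<le> C * H_norm \<Phi>1 u)"

text \<open>As in \<^const>\<open>onorm\<close>, the zero vector contributes the quotient \<open>0 / 0 = 0\<close>.
  The supremum of reals is the operator norm only when \<^const>\<open>embedding_bounded\<close> holds.\<close>

definition embedding_norm :: "(complex \<Rightarrow> real) \<Rightarrow> (complex \<Rightarrow> real) \<Rightarrow> real" where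
  "embedding_norm \<Phi>1 \<Phi>2 =
     (SUP u \<in> embedding_domain \<Phi>1 \<Phi>2. H_norm \<Phi>2 u / H_norm \<Phi>1 u)"

lemma wirtinger_quadratic:
  fixes p q r :: real
  assumes "\<And>z. \<Phi> z = p * (Re z)\<^sup>2 + q * Re z * Im z + r * (Im z)\<^sup>2"
  shows "wirtinger (\<lambda>z. complex_of_real (\<Phi> z)) =
           (\<lambda>z. Complex (p * Re z + q * Im z / 2) (- (q * Re z / 2 + r * Im z)))"
proof
  fix z
  have "((\<lambda>t. complex_of_real (\<Phi> (z + complex_of_real t)))
          has_vector_derivative complex_of_real (2 * p * Re z + q * Im z)) (at 0)"
    unfolding assms
    by (rule has_vector_derivative_of_real) (auto intro!: derivative_eq_intros)
  then have re: "partial_Re (\<lambda>z. complex_of_real (\<Phi> z)) z =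
      complex_of_real (2 * p * Re z + q * Im z)"
    unfolding partial_Re_def by (rule vector_derivative_at)
  have "((\<lambda>t. complex_of_real (\<Phi> (z + \<i> * complex_of_real t)))
          has_vector_derivative complex_of_real (q * Re z + 2 * r * Im z)) (at 0)"
    unfolding assms
    by (rule has_vector_derivative_of_real) (auto intro!: derivative_eq_intros)
  then have im: "partial_Im (\<lambda>z. complex_of_real (\<Phi> z)) z =
      complex_of_real (q * Re z + 2 * r * Im z)"
    unfolding partial_Im_def by (rule vector_derivative_at)
  show "wirtinger (\<lambda>z. complex_of_real (\<Phi> z)) z =
      Complex (p * Re z + q * Im z / 2) (- (q * Re z / 2 + r * Im z))"
    unfolding wirtinger_def re im by (simp add: complex_eq_iff field_simps)
qed

lemma partial_linear:
  fixes c d :: complex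
  shows "partial_Re (\<lambda>z. c * complex_of_real (Re z) + d * complex_of_real (Im z)) z = c"
    and "partial_Im (\<lambda>z. c * complex_of_real (Re z) + d * complex_of_real (Im z)) z = d"
proof -
  have "((\<lambda>t. c * complex_of_real (x + t) + e) has_vector_derivative c) (at 0)" for c e x
    unfolding has_vector_derivative_def
    by (auto intro!: derivative_eq_intros simp: scaleR_conv_of_real fun_eq_iff)
  note lin = this[THEN vector_derivative_at]
  show "partial_Re (\<lambda>z. c * complex_of_real (Re z) + d * complex_of_real (Im z)) z = c"
    using lin[of c "Re z" "d * complex_of_real (Im z)"] by (simp add: partial_Re_def)
  show "partial_Im (\<lambda>z. c * complex_of_real (Re z) + d * complex_of_real (Im z)) z = d"
    using lin[of d "Im z" "c * complex_of_real (Re z)"] by (simp add: partial_Im_def add.commute)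
qed

lemma mixed_wirtinger_quadratic:
  fixes p q r :: real
  assumes "\<And>z. \<Phi> z = p * (Re z)\<^sup>2 + q * Re z * Im z + r * (Im z)\<^sup>2"
  shows "wirtinger_bar (wirtinger (\<lambda>z. complex_of_real (\<Phi> z))) z = complex_of_real ((p + r) / 2)"
    and "levi \<Phi> z = (p + r) / 2"
    and "holo_hessian \<Phi> z = Complex ((p - r) / 2) (- q / 2)"
proof -
  have *: "wirtinger (\<lambda>z. complex_of_real (\<Phi> z)) =
      (\<lambda>z. Complex p (- q / 2) * complex_of_real (Re z)
         + Complex (q / 2) (- r) * complex_of_real (Im z))"
    by (subst wirtinger_quadratic[OF assms]) (auto simp: fun_eq_iff complex_eq_iff)
  show 1: "wirtinger_bar (wirtinger (\<lambda>z. complex_of_real (\<Phi> z))) z = complex_of_real ((p + r) / 2)"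
    unfolding * wirtinger_bar_def partial_linear by (auto simp: complex_eq_iff)
  show "levi \<Phi> z = (p + r) / 2"
    unfolding levi_def 1 by simp
  show "holo_hessian \<Phi> z = Complex ((p - r) / 2) (- q / 2)"
    unfolding holo_hessian_def * unfolding wirtinger_def partial_linear
    by (auto simp: complex_eq_iff)
qed

end

theory Submission
  imports Defs "HOL-Probability.Distributions" "HOL-Complex_Analysis.Cauchy_Integral_Formula"
begin

text \<open>A complex scaling and multiplication by the exponential of a holomorphic quadratic form reduce
  to \<open>\<Phi>1 = \<bar>z\<bar>\<^sup>2\<close> and \<open>\<Phi>2 = A x\<^sup>2 + B y\<^sup>2\<close>, where \<open>A = a + b\<close> and
  \<open>B = a - b\<close>. Write \<open>f = u exp (\<beta> z\<^sup>2)\<close>. Then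
  \<open>\<bar>u\<bar>\<^sup>2 exp (- 2 \<Phi>1) = \<bar>f\<bar>\<^sup>2 exp (- 2 (1 + \<beta>) x\<^sup>2 - 2 (1 - \<beta>) y\<^sup>2)\<close> and
  \<open>\<bar>u\<bar>\<^sup>2 exp (- 2 \<Phi>2) = \<bar>f\<bar>\<^sup>2 exp (- 2 (A + \<beta>) x\<^sup>2 - 2 (B - \<beta>) y\<^sup>2)\<close>.
  For \<open>\<beta> = - \<gamma>\<close> the first Gaussian weight is a multiple of the convolution of the second
  with an isotropic Gaussian. Since \<open>\<bar>f\<bar>\<^sup>2\<close> is subharmonic, this convolution can only increase
  the integral, which bounds the norm by the stated constant. For \<open>B > 1\<close> equality holds at
  \<open>f = 1\<close>, that is at \<open>u = exp (- \<beta> z\<^sup>2)\<close>.\<close>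

section \<open>Lebesgue measure on the complex plane and linear changes of variable\<close>

lemma borel_measurable_Complex [measurable]:
  assumes "f \<in> borel_measurable M" "g \<in> borel_measurable M"
  shows "(\<lambda>x. Complex (f x) (g x)) \<in> borel_measurable M"
  unfolding Complex_eq using assms by measurable

lemma borel_measurable_case_prod_Complex [measurable]:
  "(\<lambda>(x, y). Complex x y) \<in> borel_measurable borel"
  unfolding Complex_eq split_beta'
  by (intro borel_measurable_continuous_onI continuous_intros)

text \<open>Lebesgue measure is determined by its values on boxes, and the preimage under
  \<open>Complex\<close> of a box in the plane is the box of its real and imaginary parts, with the
  same side lengths. This gives Fubini in \<open>Re\<close> and \<open>Im\<close>.\<close>

lemma lborel_complex: "lborel = distr lborel borel (\<lambda>(x, y). Complex x y)"
proof (rule lborel_eqI)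
  fix l u :: complex
  assume le: "\<And>b. b \<in> Basis \<Longrightarrow> l \<bullet> b \<le> u \<bullet> b"
  have vim: "(\<lambda>(x, y). Complex x y) -` box l u = box (Re l, Im l) (Re u, Im u)"
    by (auto simp: box_def Basis_complex_def Basis_prod_def inner_complex_def)
  have "emeasure (distr lborel borel (\<lambda>(x, y). Complex x y)) (box l u)
    = emeasure lborel (box (Re l, Im l) (Re u, Im u))"
    by (subst emeasure_distr) (simp_all add: vim)
  also have "\<dots> = (\<Prod>b\<in>Basis. ((Re u, Im u) - (Re l, Im l)) \<bullet> b)"
    using le[of 1] le[of \<i>]
    by (intro emeasure_lborel_box) (auto simp: Basis_prod_def Basis_complex_def inner_complex_def)
  also have "(\<Prod>b\<in>Basis. ((Re u, Im u) - (Re l, Im l)) \<bullet> b) = (\<Prod>b\<in>Basis. (u - l) \<bullet> b)"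
    by (simp add: Basis_prod_def Basis_complex_def inner_complex_def)
  finally show "emeasure (distr lborel borel (\<lambda>(x, y). Complex x y)) (box l u)
    = (\<Prod>b\<in>Basis. (u - l) \<bullet> b)" .
qed simp

lemma nn_integral_complex:
  fixes F :: "complex \<Rightarrow> ennreal"
  assumes [measurable]: "F \<in> borel_measurable borel"
  shows "(\<integral>\<^sup>+z. F z \<partial>lborel) = (\<integral>\<^sup>+x. \<integral>\<^sup>+y. F (Complex x y) \<partial>lborel \<partial>lborel)"
proof -
  have "(\<integral>\<^sup>+z. F z \<partial>lborel) = (\<integral>\<^sup>+p. F (case p of (x, y) \<Rightarrow> Complex x y) \<partial>(lborel \<Otimes>\<^sub>M lborel))"
    by (subst lborel_complex, subst nn_integral_distr) (simp_all add: lborel_prod)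
  also have "\<dots> = (\<integral>\<^sup>+x. \<integral>\<^sup>+y. F (Complex x y) \<partial>lborel \<partial>lborel)"
    by (subst lborel.nn_integral_fst[symmetric]) (simp_all add: split_beta')
  finally show ?thesis .
qed

lemma nn_integral_swap_real:
  fixes F :: "real \<Rightarrow> real \<Rightarrow> ennreal"
  assumes [measurable]: "(\<lambda>(x, y). F x y) \<in> borel_measurable (borel \<Otimes>\<^sub>M borel)"
  shows "(\<integral>\<^sup>+x. \<integral>\<^sup>+y. F x y \<partial>lborel \<partial>lborel) = (\<integral>\<^sup>+y. \<integral>\<^sup>+x. F x y \<partial>lborel \<partial>lborel)"
  by (rule lborel_pair.Fubini') simp

text \<open>The real matrix of multiplication by \<open>c\<close> has determinant |c|^2. The
  substitution is done one variable at a time by affine maps and Fubini; this needs a nonzero pivot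
  \<open>p\<close>, and for \<open>p = 0\<close> the map only scales and swaps the
  coordinates.\<close>

lemma nn_integral_complex_mult:
  fixes F :: "complex \<Rightarrow> ennreal"
  assumes [measurable]: "F \<in> borel_measurable borel" and c: "c \<noteq> 0"
  shows "(\<integral>\<^sup>+z. F z \<partial>lborel) = ennreal ((cmod c)\<^sup>2) * (\<integral>\<^sup>+z. F (c * z) \<partial>lborel)"
proof -
  obtain p q where cpq: "c = Complex p q" by (cases c)
  have n: "(cmod c)\<^sup>2 = p\<^sup>2 + q\<^sup>2" by (simp add: cpq cmod_power2)
  have pos: "p\<^sup>2 + q\<^sup>2 > 0" using c by (simp add: cpq complex_eq_iff sum_power2_gt_zero_iff)
  have mult: "c * Complex x y = Complex (p * x - q * y) (p * y + q * x)" for x y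
    by (simp add: cpq complex_eq_iff)
  have J: "(\<integral>\<^sup>+z. F (c * z) \<partial>lborel) =
    (\<integral>\<^sup>+x. \<integral>\<^sup>+y. F (Complex (p * x - q * y) (p * y + q * x)) \<partial>lborel \<partial>lborel)"
    by (subst nn_integral_complex) (simp_all add: mult)
  show ?thesis
  proof (cases "p = 0")
    case True
    then have q: "q \<noteq> 0" using pos by auto
    have "(\<integral>\<^sup>+z. F z \<partial>lborel) = (\<integral>\<^sup>+x. \<integral>\<^sup>+y. F (Complex x y) \<partial>lborel \<partial>lborel)"
      by (rule nn_integral_complex) simp
    also have "\<dots> = ennreal \<bar>- q\<bar> * (\<integral>\<^sup>+x. \<integral>\<^sup>+y. F (Complex (- q * x) y) \<partial>lborel \<partial>lborel)"
      using nn_integral_real_affine[of "\<lambda>x. \<integral>\<^sup>+y. F (Complex x y) \<partial>lborel" "- q" 0] q by simp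
    also have "(\<integral>\<^sup>+x. \<integral>\<^sup>+y. F (Complex (- q * x) y) \<partial>lborel \<partial>lborel)
      = (\<integral>\<^sup>+x. ennreal \<bar>q\<bar> * (\<integral>\<^sup>+y. F (Complex (- q * x) (q * y)) \<partial>lborel) \<partial>lborel)"
      using nn_integral_real_affine[of "\<lambda>y. F (Complex (- q * x) y)" q 0 for x] q by simp
    also have "\<dots> = ennreal \<bar>q\<bar> * (\<integral>\<^sup>+x. \<integral>\<^sup>+y. F (Complex (- q * x) (q * y)) \<partial>lborel \<partial>lborel)"
      by (simp add: nn_integral_cmult)
    also have "(\<integral>\<^sup>+x. \<integral>\<^sup>+y. F (Complex (- q * x) (q * y)) \<partial>lborel \<partial>lborel)
      = (\<integral>\<^sup>+y. \<integral>\<^sup>+x. F (Complex (- q * x) (q * y)) \<partial>lborel \<partial>lborel)"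
      by (rule nn_integral_swap_real) simp
    also have "\<dots> = (\<integral>\<^sup>+z. F (c * z) \<partial>lborel)"
      by (simp add: J True)
    finally have 1: "(\<integral>\<^sup>+z. F z \<partial>lborel) = ennreal \<bar>- q\<bar> * (ennreal \<bar>q\<bar> * (\<integral>\<^sup>+z. F (c * z) \<partial>lborel))" .
    have "ennreal ((cmod c)\<^sup>2) = ennreal \<bar>- q\<bar> * ennreal \<bar>q\<bar>"
      unfolding n by (simp add: True ennreal_mult[symmetric] power2_eq_square)
    then show ?thesis
      unfolding 1 by (simp add: mult.assoc)
  next
    case False
    \<comment> \<open>Once the first coordinate of \<open>c * z\<close> is taken as the new variable
      \<open>x\<close>, the second one is \<open>q / p * x + r * y\<close>. So \<open>r\<close> is
      the second pivot of the elimination, and p r = |c|^2.\<close>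
    define r where "r = (p\<^sup>2 + q\<^sup>2) / p"
    have r: "r \<noteq> 0" using False pos by (simp add: r_def)
    have "(\<integral>\<^sup>+z. F (c * z) \<partial>lborel) =
       (\<integral>\<^sup>+y. \<integral>\<^sup>+x. F (Complex (p * x - q * y) (p * y + q * x)) \<partial>lborel \<partial>lborel)"
      unfolding J by (rule nn_integral_swap_real) simp
    also have "\<dots> = (\<integral>\<^sup>+y. ennreal \<bar>1 / p\<bar> *
        (\<integral>\<^sup>+x. F (Complex x (q / p * x + r * y)) \<partial>lborel) \<partial>lborel)"
    proof (rule nn_integral_cong)
      fix y
      have "p * (q * y / p + 1 / p * x) - q * y = x"
        "p * y + q * (q * y / p + 1 / p * x) = q / p * x + r * y" for x
        using False by (auto simp: field_simps r_def power2_eq_square)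
      then show "(\<integral>\<^sup>+x. F (Complex (p * x - q * y) (p * y + q * x)) \<partial>lborel) =
          ennreal \<bar>1 / p\<bar> * (\<integral>\<^sup>+x. F (Complex x (q / p * x + r * y)) \<partial>lborel)"
        using nn_integral_real_affine[of "\<lambda>x. F (Complex (p * x - q * y) (p * y + q * x))" "1 / p" "q * y / p"] False
        by simp
    qed
    also have "\<dots> = ennreal \<bar>1 / p\<bar> * (\<integral>\<^sup>+y. \<integral>\<^sup>+x. F (Complex x (q / p * x + r * y)) \<partial>lborel \<partial>lborel)"
      by (simp add: nn_integral_cmult)
    also have "(\<integral>\<^sup>+y. \<integral>\<^sup>+x. F (Complex x (q / p * x + r * y)) \<partial>lborel \<partial>lborel)
       = (\<integral>\<^sup>+x. \<integral>\<^sup>+y. F (Complex x (q / p * x + r * y)) \<partial>lborel \<partial>lborel)"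
      by (rule nn_integral_swap_real) simp
    finally have 1: "(\<integral>\<^sup>+z. F (c * z) \<partial>lborel) = ennreal \<bar>1 / p\<bar> * \<dots>" .
    have "(\<integral>\<^sup>+z. F z \<partial>lborel) = (\<integral>\<^sup>+x. \<integral>\<^sup>+y. F (Complex x y) \<partial>lborel \<partial>lborel)"
      by (rule nn_integral_complex) simp
    also have "\<dots> = (\<integral>\<^sup>+x. ennreal \<bar>r\<bar> * (\<integral>\<^sup>+y. F (Complex x (q / p * x + r * y)) \<partial>lborel) \<partial>lborel)"
      using nn_integral_real_affine[of "\<lambda>y. F (Complex x y)" r "q / p * x" for x] r
      by (intro nn_integral_cong) simp
    also have "\<dots> = ennreal \<bar>r\<bar> * (\<integral>\<^sup>+x. \<integral>\<^sup>+y. F (Complex x (q / p * x + r * y)) \<partial>lborel \<partial>lborel)"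
      by (simp add: nn_integral_cmult)
    finally have 2: "(\<integral>\<^sup>+z. F z \<partial>lborel) = \<dots>" .
    have "\<bar>r\<bar> = (cmod c)\<^sup>2 * \<bar>1 / p\<bar>"
      using pos by (simp add: n r_def abs_mult)
    then have "ennreal \<bar>r\<bar> = ennreal ((cmod c)\<^sup>2) * ennreal \<bar>1 / p\<bar>"
      by (simp only: ennreal_mult abs_ge_zero zero_le_power2)
    then show ?thesis
      unfolding 1 2 by (simp only: mult.assoc)
  qed
qed

section \<open>Gaussian integrals in one and two real variables\<close>

lemma nn_integral_exp_quadratic:
  fixes c m :: real
  assumes "c > 0"
  shows "(\<integral>\<^sup>+x. ennreal (exp (- c * (x - m)\<^sup>2)) \<partial>lborel) = ennreal (sqrt (pi / c))"
proof -
  define s where "s = sqrt (1 / (2 * c))"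
  have s: "s > 0" "s\<^sup>2 = 1 / (2 * c)" using assms by (auto simp: s_def)
  have eq: "exp (- c * (x - m)\<^sup>2) = sqrt (pi / c) * normal_density m s x" for x
    using assms by (simp add: normal_density_def s(2) real_sqrt_divide field_simps)
  have "(\<integral>\<^sup>+x. ennreal (normal_density m s x) \<partial>lborel) = ennreal 1"
    using s by (subst nn_integral_eq_integral)
      (auto simp: integral_normal_density integrable_normal_density)
  then show ?thesis
    using assms unfolding eq by (simp add: ennreal_mult nn_integral_cmult)
qed

lemma nn_integral_exp_quadratic_infinite:
  fixes c :: real
  assumes "c \<le> 0"
  shows "(\<integral>\<^sup>+x. ennreal (exp (- c * x\<^sup>2)) \<partial>lborel) = \<infinity>"
proof -
  have "integral\<^sup>N lborel (\<lambda>x::real. 1) \<le> (\<integral>\<^sup>+x. ennreal (exp (- c * x\<^sup>2)) \<partial>lborel)"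
    using assms by (intro nn_integral_mono) (simp add: one_ennreal_def[symmetric] ennreal_leI mult_nonpos_nonneg flip: ennreal_1)
  then show ?thesis by (simp add: top_unique)
qed

text \<open>Completing the square in \<open>t\<close> leaves a Gaussian centred at
  \<open>S * x / (P + S)\<close>. For nonzero \<open>P\<close> the new exponent expresses that
  reciprocal exponents add under convolution.\<close>

lemma nn_integral_gaussian_convolution:
  fixes P S x :: real
  assumes "S > 0" "P + S > 0"
  shows "(\<integral>\<^sup>+t. ennreal (exp (- P * t\<^sup>2 - S * (x - t)\<^sup>2)) \<partial>lborel)
    = ennreal (sqrt (pi / (P + S)) * exp (- (P * S / (P + S)) * x\<^sup>2))"
proof -
  have "- P * t\<^sup>2 - S * (x - t)\<^sup>2 =
      - (P * S / (P + S)) * x\<^sup>2 + (- (P + S) * (t - S * x / (P + S))\<^sup>2)" for t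
    using assms by (simp add: divide_simps) algebra
  then have "exp (- P * t\<^sup>2 - S * (x - t)\<^sup>2) =
      exp (- (P * S / (P + S)) * x\<^sup>2) * exp (- (P + S) * (t - S * x / (P + S))\<^sup>2)" for t
    by (metis exp_add)
  then have "(\<integral>\<^sup>+t. ennreal (exp (- P * t\<^sup>2 - S * (x - t)\<^sup>2)) \<partial>lborel)
    = ennreal (exp (- (P * S / (P + S)) * x\<^sup>2)) *
      (\<integral>\<^sup>+t. ennreal (exp (- (P + S) * (t - S * x / (P + S))\<^sup>2)) \<partial>lborel)"
    by (simp add: ennreal_mult nn_integral_cmult)
  then show ?thesis
    using assms by (subst (asm) nn_integral_exp_quadratic) (simp_all add: ennreal_mult mult.commute)
qed

lemma nn_integral_complex_product:
  fixes f g :: "real \<Rightarrow> ennreal"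
  assumes [measurable]: "f \<in> borel_measurable borel" "g \<in> borel_measurable borel"
  shows "(\<integral>\<^sup>+z. f (Re z) * g (Im z) \<partial>lborel) = (\<integral>\<^sup>+x. f x \<partial>lborel) * (\<integral>\<^sup>+y. g y \<partial>lborel)"
  by (subst nn_integral_complex) (simp_all add: nn_integral_cmult nn_integral_multc)

section \<open>The sub-mean-value property, averaged against Gaussians\<close>

text \<open>Cauchy's formula at 0 for x -> f (z + w x) on the unit circle. Keeping the complex
  \<open>w\<close> inside the function, instead of a radius in the path, covers \<open>w = 0\<close>
  and lets the formula be integrated over \<open>w\<close> in the plane.\<close>

lemma mean_value_circle:
  assumes "f holomorphic_on UNIV"
  shows "((\<lambda>t. f (z + w * exp (2 * of_real pi * \<i> * of_real t))) has_integral f z) {0..1}"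
proof -
  define h where "h = (\<lambda>x. f (z + w * x))"
  have h: "h holomorphic_on UNIV"
    unfolding h_def by (rule holomorphic_on_compose_gen[OF _ assms, unfolded o_def])
      (auto intro!: holomorphic_intros)
  have "((\<lambda>u. h u / (u - 0)) has_contour_integral 2 * of_real pi * \<i> * h 0) (circlepath 0 1)"
    by (rule Cauchy_integral_circlepath_simple) (auto intro: holomorphic_on_subset[OF h])
  then have "((\<lambda>x. h (exp (2 * of_real pi * \<i> * of_real x)) * (2 * of_real pi * \<i>))
      has_integral (h 0 * (2 * of_real pi * \<i>))) {0..1}"
    unfolding has_contour_integral vector_derivative_circlepath
    by (simp add: circlepath mult_ac)
  then have "((\<lambda>x. h (exp (2 * of_real pi * \<i> * of_real x)) * (2 * of_real pi * \<i>) / (2 * of_real pi * \<i>))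
      has_integral (h 0 * (2 * of_real pi * \<i>) / (2 * of_real pi * \<i>))) {0..1}"
    by (rule has_integral_divide)
  then show ?thesis by (simp add: h_def)
qed

lemma subharmonic_circle:
  assumes f: "f holomorphic_on UNIV"
  shows "ennreal (cmod (f z)) \<le>
    (\<integral>\<^sup>+t. ennreal (cmod (f (z + w * exp (2 * of_real pi * \<i> * of_real t)))) * indicator {0..1} t \<partial>lborel)"
proof -
  let ?h = "\<lambda>t::real. f (z + w * exp (2 * of_real pi * \<i> * of_real t))"
  have cont: "continuous_on S ?h" for S
    by (rule continuous_on_compose2[OF holomorphic_on_imp_continuous_on[OF f]])
       (auto intro!: continuous_intros)
  have int: "set_integrable lborel {0..1} ?h"
    by (rule borel_integrable_atLeastAtMost') (rule cont)
  have "f z = integral {0..1} ?h"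
    using mean_value_circle[OF f, of z w] by (simp add: integral_unique)
  also have "\<dots> = (LINT t:{0..1}|lborel. ?h t)"
    using set_borel_integral_eq_integral(2)[OF int] by simp
  finally have "ennreal (cmod (f z)) = ennreal (norm (LINT t:{0..1}|lborel. ?h t))" by simp
  also have "\<dots> \<le> (\<integral>\<^sup>+t. ennreal (norm (indicator {0..1} t *\<^sub>R ?h t)) \<partial>lborel)"
    unfolding set_lebesgue_integral_def
    by (rule integral_norm_bound_ennreal) (use int in \<open>simp add: set_integrable_def\<close>)
  also have "\<dots> = (\<integral>\<^sup>+t. ennreal (cmod (?h t)) * indicator {0..1} t \<partial>lborel)"
    by (intro nn_integral_cong) (auto split: split_indicator)
  finally show ?thesis .
qed

lemma entire_borel_measurable:
  "f holomorphic_on UNIV \<Longrightarrow> f \<in> borel_measurable borel"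
  by (intro borel_measurable_continuous_onI holomorphic_on_imp_continuous_on)

lemma nn_integral_complex_gaussian:
  assumes "S > 0"
  shows "(\<integral>\<^sup>+w. ennreal (exp (- S * (cmod w)\<^sup>2)) \<partial>lborel) = ennreal (pi / S)"
proof -
  have "(\<integral>\<^sup>+w. ennreal (exp (- S * (cmod w)\<^sup>2)) \<partial>lborel)
    = (\<integral>\<^sup>+w. ennreal (exp (- S * (Re w)\<^sup>2)) * ennreal (exp (- S * (Im w)\<^sup>2)) \<partial>lborel)"
    by (intro nn_integral_cong)
       (simp add: ennreal_mult[symmetric] cmod_power2 algebra_simps flip: exp_add)
  also have "\<dots> = ennreal (sqrt (pi / S)) * ennreal (sqrt (pi / S))"
    using nn_integral_exp_quadratic[OF assms, of 0]
    by (subst nn_integral_complex_product) simp_all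
  also have "\<dots> = ennreal (pi / S)"
    using assms by (simp flip: ennreal_mult)
  finally show ?thesis .
qed

text \<open>Bound |f z| by its mean over the circle through \<open>z + w\<close>, integrate against
  the Gaussian in \<open>w\<close>, and exchange the integrals. For each angle the inner integral is
  the same, since a rotation preserves both Lebesgue measure and the Gaussian.\<close>

lemma subharmonic_gaussian:
  assumes f: "f holomorphic_on UNIV" and S: "S > 0"
  shows "ennreal (pi / S) * ennreal (cmod (f z)) \<le>
    (\<integral>\<^sup>+w. ennreal (cmod (f (z + w)) * exp (- S * (cmod w)\<^sup>2)) \<partial>lborel)"
proof -
  note [measurable] = entire_borel_measurable[OF f]
  let ?e = "\<lambda>t::real. exp (2 * of_real pi * \<i> * of_real t) :: complex"
  let ?I = "\<integral>\<^sup>+w. ennreal (cmod (f (z + w)) * exp (- S * (cmod w)\<^sup>2)) \<partial>lborel"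
  have [measurable]: "?e \<in> borel_measurable borel"
    by (intro borel_measurable_continuous_onI continuous_intros)
  have e: "cmod (?e t) = 1" for t
    by simp
  have rot: "?I = (\<integral>\<^sup>+w. ennreal (cmod (f (z + w * ?e t)) * exp (- S * (cmod w)\<^sup>2)) \<partial>lborel)" for t
    by (subst nn_integral_complex_mult[of _ "?e t"]) (simp_all add: norm_mult mult.commute)
  have "ennreal (pi / S) * ennreal (cmod (f z))
    = (\<integral>\<^sup>+w. ennreal (exp (- S * (cmod w)\<^sup>2)) * ennreal (cmod (f z)) \<partial>lborel)"
    using nn_integral_complex_gaussian[OF S] by (simp add: nn_integral_multc)
  also have "\<dots> \<le> (\<integral>\<^sup>+w. ennreal (exp (- S * (cmod w)\<^sup>2)) *
      (\<integral>\<^sup>+t. ennreal (cmod (f (z + w * ?e t))) * indicator {0..1} t \<partial>lborel) \<partial>lborel)"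
    by (intro nn_integral_mono mult_left_mono subharmonic_circle[OF f]) simp
  also have "\<dots> = (\<integral>\<^sup>+w. \<integral>\<^sup>+t. ennreal (exp (- S * (cmod w)\<^sup>2)) *
      (ennreal (cmod (f (z + w * ?e t))) * indicator {0..1} t) \<partial>lborel \<partial>lborel)"
    by (simp add: nn_integral_cmult)
  also have "\<dots> = (\<integral>\<^sup>+t. \<integral>\<^sup>+w. ennreal (exp (- S * (cmod w)\<^sup>2)) *
      (ennreal (cmod (f (z + w * ?e t))) * indicator {0..1} t) \<partial>lborel \<partial>lborel)"
    by (rule lborel_pair.Fubini') simp
  also have "\<dots> = (\<integral>\<^sup>+t. ?I * indicator {0..1::real} t \<partial>lborel)"
  proof (rule nn_integral_cong)
    fix t :: real
    have "(\<integral>\<^sup>+w. ennreal (exp (- S * (cmod w)\<^sup>2)) *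
      (ennreal (cmod (f (z + w * ?e t))) * indicator {0..1} t) \<partial>lborel)
     = (\<integral>\<^sup>+w. ennreal (cmod (f (z + w * ?e t)) * exp (- S * (cmod w)\<^sup>2)) * indicator {0..1} t \<partial>lborel)"
      by (intro nn_integral_cong) (simp add: ennreal_mult mult_ac)
    then show "(\<integral>\<^sup>+w. ennreal (exp (- S * (cmod w)\<^sup>2)) *
      (ennreal (cmod (f (z + w * ?e t))) * indicator {0..1} t) \<partial>lborel) = ?I * indicator {0..1} t"
      unfolding rot[of t] by (simp add: nn_integral_multc)
  qed
  also have "\<dots> = ?I"
    by (simp add: nn_integral_cmult)
  finally show ?thesis .
qed

text \<open>The weight on the right is, up to a constant, the weight on the left convolved with the
  isotropic Gaussian \<^term>\<open>\<lambda>w. exp (- S * (cmod w)\<^sup>2)\<close>, so the inequality is the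
  sub-mean-value property of \<open>\<bar>f\<bar>\<^sup>2\<close> integrated against the left weight. The exponents
  \<open>P\<close>, \<open>R\<close> may vanish; the degenerate case \<open>a - b = 1\<close> relies on this.\<close>

lemma gaussian_weight_monotone:
  fixes P R S :: real
  assumes f: "f holomorphic_on UNIV" and S: "S > 0" and P: "P + S > 0" and R: "R + S > 0"
  shows "(\<integral>\<^sup>+z. ennreal ((cmod (f z))\<^sup>2 * exp (- P * (Re z)\<^sup>2 - R * (Im z)\<^sup>2)) \<partial>lborel)
    \<le> ennreal (S / sqrt ((P + S) * (R + S))) *
      (\<integral>\<^sup>+z. ennreal ((cmod (f z))\<^sup>2 *
         exp (- (P * S / (P + S)) * (Re z)\<^sup>2 - (R * S / (R + S)) * (Im z)\<^sup>2)) \<partial>lborel)"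
proof -
  let ?W = "\<lambda>z. exp (- P * (Re z)\<^sup>2 - R * (Im z)\<^sup>2)"
  let ?V = "\<lambda>z. exp (- (P * S / (P + S)) * (Re z)\<^sup>2 - (R * S / (R + S)) * (Im z)\<^sup>2)"
  let ?c = "sqrt (pi / (P + S)) * sqrt (pi / (R + S))"
  note [measurable] = entire_borel_measurable[OF f]
  \<comment> \<open>Squaring \<open>f\<close> turns the inequality for moduli of entire functions
    into one for |f|^2.\<close>
  have f2: "(\<lambda>z. (f z)\<^sup>2) holomorphic_on UNIV"
    by (intro holomorphic_intros f)
  have sub: "ennreal (pi / S) * ennreal ((cmod (f z))\<^sup>2) \<le>
      (\<integral>\<^sup>+v. ennreal ((cmod (f v))\<^sup>2 * exp (- S * (cmod (v - z))\<^sup>2)) \<partial>lborel)" for z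
  proof -
    have "(\<integral>\<^sup>+v. ennreal ((cmod (f v))\<^sup>2 * exp (- S * (cmod (v - z))\<^sup>2)) \<partial>lborel)
      = (\<integral>\<^sup>+w. ennreal ((cmod (f (z + w)))\<^sup>2 * exp (- S * (cmod w)\<^sup>2)) \<partial>lborel)"
      by (subst (1) lborel_distr_plus[of z, symmetric], subst nn_integral_distr) simp_all
    then show ?thesis
      using subharmonic_gaussian[OF f2 S, of z] by (simp add: norm_power)
  qed
  \<comment> \<open>The isotropic kernel is a product in real and imaginary parts, so this is two
    one-dimensional convolutions.\<close>
  have conv: "(\<integral>\<^sup>+z. ennreal (?W z * exp (- S * (cmod (v - z))\<^sup>2)) \<partial>lborel) = ennreal (?c * ?V v)" for v
  proof -
    have "(\<integral>\<^sup>+z. ennreal (?W z * exp (- S * (cmod (v - z))\<^sup>2)) \<partial>lborel)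
      = (\<integral>\<^sup>+z. ennreal (exp (- P * (Re z)\<^sup>2 - S * (Re v - Re z)\<^sup>2)) *
            ennreal (exp (- R * (Im z)\<^sup>2 - S * (Im v - Im z)\<^sup>2)) \<partial>lborel)"
      by (intro nn_integral_cong)
         (simp add: ennreal_mult[symmetric] cmod_power2 algebra_simps flip: exp_add)
    also have "\<dots> = ennreal (sqrt (pi / (P + S)) * exp (- (P * S / (P + S)) * (Re v)\<^sup>2)) *
       ennreal (sqrt (pi / (R + S)) * exp (- (R * S / (R + S)) * (Im v)\<^sup>2))"
      using nn_integral_gaussian_convolution[OF S P, of "Re v"] nn_integral_gaussian_convolution[OF S R, of "Im v"]
      by (subst nn_integral_complex_product) simp_all
    also have "\<dots> = ennreal (?c * ?V v)"
    proof -
      have "?V v = exp (- (P * S / (P + S)) * (Re v)\<^sup>2) * exp (- (R * S / (R + S)) * (Im v)\<^sup>2)"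
        by (simp flip: exp_add)
      then show ?thesis
        using P R by (simp only: ennreal_mult[symmetric] real_sqrt_ge_zero divide_nonneg_pos pi_ge_zero exp_ge_zero mult_nonneg_nonneg mult_ac)
    qed
    finally show ?thesis .
  qed
  have "ennreal (pi / S) * (\<integral>\<^sup>+z. ennreal ((cmod (f z))\<^sup>2 * ?W z) \<partial>lborel)
    = (\<integral>\<^sup>+z. ennreal (pi / S) * ennreal ((cmod (f z))\<^sup>2) * ennreal (?W z) \<partial>lborel)"
    by (simp add: nn_integral_cmult[symmetric] ennreal_mult mult.assoc)
  also have "\<dots> \<le> (\<integral>\<^sup>+z. (\<integral>\<^sup>+v. ennreal ((cmod (f v))\<^sup>2 * exp (- S * (cmod (v - z))\<^sup>2)) \<partial>lborel) * ennreal (?W z) \<partial>lborel)"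
    by (intro nn_integral_mono mult_right_mono sub) simp
  also have "\<dots> = (\<integral>\<^sup>+z. \<integral>\<^sup>+v. ennreal ((cmod (f v))\<^sup>2) * ennreal (?W z * exp (- S * (cmod (v - z))\<^sup>2)) \<partial>lborel \<partial>lborel)"
    by (intro nn_integral_cong, subst nn_integral_multc[symmetric]) (simp_all add: ennreal_mult mult_ac)
  also have "\<dots> = (\<integral>\<^sup>+v. \<integral>\<^sup>+z. ennreal ((cmod (f v))\<^sup>2) * ennreal (?W z * exp (- S * (cmod (v - z))\<^sup>2)) \<partial>lborel \<partial>lborel)"
    by (rule lborel_pair.Fubini') simp
  also have "\<dots> = (\<integral>\<^sup>+v. ennreal ((cmod (f v))\<^sup>2) * ennreal (?c * ?V v) \<partial>lborel)"
    by (intro nn_integral_cong, subst nn_integral_cmult) (simp_all only: conv, simp_all)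
  also have "\<dots> = (\<integral>\<^sup>+v. ennreal ?c * ennreal ((cmod (f v))\<^sup>2 * ?V v) \<partial>lborel)"
    using P R by (simp add: ennreal_mult mult_ac)
  also have "\<dots> = ennreal ?c * (\<integral>\<^sup>+v. ennreal ((cmod (f v))\<^sup>2 * ?V v) \<partial>lborel)"
    by (simp add: nn_integral_cmult)
  \<comment> \<open>Multiplying by \<open>S / pi\<close> removes the factor \<open>pi / S\<close>
    while the integrals may still be infinite.\<close>
  finally have "ennreal (S / pi) * (ennreal (pi / S) * (\<integral>\<^sup>+z. ennreal ((cmod (f z))\<^sup>2 * ?W z) \<partial>lborel))
    \<le> ennreal (S / pi) * (ennreal ?c * (\<integral>\<^sup>+v. ennreal ((cmod (f v))\<^sup>2 * ?V v) \<partial>lborel))"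
    by (rule mult_left_mono) simp
  moreover have "ennreal (S / pi) * ennreal (pi / S) = 1"
    using S by (simp flip: ennreal_mult)
  moreover have "ennreal (S / pi) * ennreal ?c = ennreal (S / sqrt ((P + S) * (R + S)))"
  proof -
    have "S / pi * ?c = S / sqrt ((P + S) * (R + S))"
      by (simp add: real_sqrt_divide real_sqrt_mult)
    then show ?thesis
      using S P R by (subst ennreal_mult[symmetric]) simp_all
  qed
  ultimately show ?thesis
    by (simp add: mult.assoc[symmetric])
qed

section \<open>Energies and the norm of the embedding\<close>

text \<open>The squared norm with values in \<open>ennreal\<close>: estimates can be stated for all
  entire \<open>u\<close>, and membership in the space becomes finiteness.\<close>

definition energy :: "(complex \<Rightarrow> real) \<Rightarrow> (complex \<Rightarrow> complex) \<Rightarrow> ennreal" where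
  "energy \<Phi> u = (\<integral>\<^sup>+z. ennreal ((cmod (u z))\<^sup>2 * exp (- 2 * \<Phi> z)) \<partial>lborel)"

lemma H_space_iff_energy:
  assumes [measurable]: "\<Phi> \<in> borel_measurable borel"
  shows "u \<in> H_space \<Phi> \<longleftrightarrow> u holomorphic_on UNIV \<and> energy \<Phi> u < \<infinity>"
proof -
  have "integrable lborel (\<lambda>z. (cmod (u z))\<^sup>2 * exp (- 2 * \<Phi> z)) \<longleftrightarrow> energy \<Phi> u < \<infinity>"
    if "u holomorphic_on UNIV"
    using entire_borel_measurable[OF that] by (simp add: integrable_iff_bounded energy_def abs_mult)
  then show ?thesis by (auto simp: H_space_def)
qed

lemma H_norm_eq_energy:
  assumes [measurable]: "\<Phi> \<in> borel_measurable borel" and "u holomorphic_on UNIV"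
  shows "H_norm \<Phi> u = sqrt (enn2real (energy \<Phi> u))"
  unfolding H_norm_def energy_def
  using entire_borel_measurable[OF assms(2)] by (subst integral_eq_nn_integral) auto

text \<open>One inequality between extended values does two things: finiteness of the first energy
  forces that of the second, hence the full domain, and on finite values it is the norm
  bound.\<close>

lemma embedding_bounded_by_energy:
  assumes meas: "\<Phi>1 \<in> borel_measurable borel" "\<Phi>2 \<in> borel_measurable borel" and K: "K \<ge> 0"
    and le: "\<forall>u. u holomorphic_on UNIV \<longrightarrow> energy \<Phi>2 u \<le> ennreal K * energy \<Phi>1 u"
  shows "embedding_domain \<Phi>1 \<Phi>2 = H_space \<Phi>1"
    and "u \<in> H_space \<Phi>1 \<Longrightarrow> H_norm \<Phi>2 u \<le> sqrt K * H_norm \<Phi>1 u"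
    and "embedding_bounded \<Phi>1 \<Phi>2"
proof -
  have fin: "energy \<Phi>2 u < \<infinity>" if "u \<in> H_space \<Phi>1" for u
  proof -
    have "energy \<Phi>2 u \<le> ennreal K * energy \<Phi>1 u" "energy \<Phi>1 u < \<infinity>"
      using that le by (auto simp: H_space_iff_energy[OF meas(1)])
    then have "ennreal K * energy \<Phi>1 u < \<infinity>"
      by (simp add: ennreal_mult_less_top)
    with \<open>energy \<Phi>2 u \<le> ennreal K * energy \<Phi>1 u\<close> show ?thesis
      by (rule le_less_trans)
  qed
  then show dom: "embedding_domain \<Phi>1 \<Phi>2 = H_space \<Phi>1"
    by (auto simp: embedding_domain_def H_space_iff_energy[OF meas(1)] H_space_iff_energy[OF meas(2)])
  have norm_le: "H_norm \<Phi>2 u \<le> sqrt K * H_norm \<Phi>1 u" if u: "u \<in> H_space \<Phi>1" for u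
  proof -
    have holo: "u holomorphic_on UNIV" and fin1: "energy \<Phi>1 u < \<infinity>"
      using u by (auto simp: H_space_iff_energy[OF meas(1)])
    have "enn2real (energy \<Phi>2 u) \<le> enn2real (ennreal K * energy \<Phi>1 u)"
      using fin1 by (intro enn2real_mono le[rule_format] holo) (simp add: ennreal_mult_less_top)
    also have "\<dots> = K * enn2real (energy \<Phi>1 u)"
      using K by (simp add: enn2real_mult)
    finally show ?thesis
      using holo by (simp add: H_norm_eq_energy meas flip: real_sqrt_mult)
  qed
  then show "u \<in> H_space \<Phi>1 \<Longrightarrow> H_norm \<Phi>2 u \<le> sqrt K * H_norm \<Phi>1 u" .
  show "embedding_bounded \<Phi>1 \<Phi>2"
    unfolding embedding_bounded_def using dom norm_le by blast
qed

lemma H_norm_nonneg: "H_norm \<Phi> u \<ge> 0"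
  unfolding H_norm_def by (intro real_sqrt_ge_zero Bochner_Integration.integral_nonneg) simp

lemma embedding_norm_bounds:
  assumes meas: "\<Phi>1 \<in> borel_measurable borel" "\<Phi>2 \<in> borel_measurable borel" and K: "K \<ge> 0"
    and le: "\<forall>u. u holomorphic_on UNIV \<longrightarrow> energy \<Phi>2 u \<le> ennreal K * energy \<Phi>1 u"
  shows "embedding_norm \<Phi>1 \<Phi>2 \<le> sqrt K"
    and "u \<in> H_space \<Phi>1 \<Longrightarrow> H_norm \<Phi>2 u / H_norm \<Phi>1 u \<le> embedding_norm \<Phi>1 \<Phi>2"
proof -
  note b = embedding_bounded_by_energy[OF meas K le]
  \<comment> \<open>If \<open>H_norm \<Phi>1 u = 0\<close>, the quotient is 0 by the convention for
    division by zero.\<close>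
  have ratio: "H_norm \<Phi>2 u / H_norm \<Phi>1 u \<le> sqrt K" if "u \<in> H_space \<Phi>1" for u
    using b(2)[OF that] H_norm_nonneg[of \<Phi>1 u] K
    by (cases "H_norm \<Phi>1 u = 0") (auto simp: divide_simps mult_ac)
  \<comment> \<open>The zero function makes the set under the supremum nonempty, as
    \<open>cSUP_least\<close> demands.\<close>
  have "(\<lambda>_. 0) \<in> H_space \<Phi>1" by (simp add: H_space_def)
  then show "embedding_norm \<Phi>1 \<Phi>2 \<le> sqrt K"
    unfolding embedding_norm_def b(1) by (intro cSUP_least ratio) auto
  show "u \<in> H_space \<Phi>1 \<Longrightarrow> H_norm \<Phi>2 u / H_norm \<Phi>1 u \<le> embedding_norm \<Phi>1 \<Phi>2"
    unfolding embedding_norm_def b(1)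
    by (intro cSUP_upper bdd_aboveI2[where M = "sqrt K"] ratio)
qed

section \<open>Weights in normal form: energy estimates and test Gaussians\<close>

lemma nn_integral_anisotropic_gaussian:
  fixes p q :: real
  assumes "p > 0"
  shows "(\<integral>\<^sup>+z. ennreal (exp (- p * (Re z)\<^sup>2 - q * (Im z)\<^sup>2)) \<partial>lborel) =
    (if q > 0 then ennreal (pi / sqrt (p * q)) else \<infinity>)"
proof -
  have "(\<integral>\<^sup>+z. ennreal (exp (- p * (Re z)\<^sup>2 - q * (Im z)\<^sup>2)) \<partial>lborel)
    = (\<integral>\<^sup>+z. ennreal (exp (- p * (Re z)\<^sup>2)) * ennreal (exp (- q * (Im z)\<^sup>2)) \<partial>lborel)"
    by (intro nn_integral_cong) (simp add: ennreal_mult[symmetric] flip: exp_add)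
  also have "\<dots> = (\<integral>\<^sup>+x. ennreal (exp (- p * x\<^sup>2)) \<partial>lborel) * (\<integral>\<^sup>+y. ennreal (exp (- q * y\<^sup>2)) \<partial>lborel)"
    by (rule nn_integral_complex_product) simp_all
  also have "(\<integral>\<^sup>+x. ennreal (exp (- p * x\<^sup>2)) \<partial>lborel) = ennreal (sqrt (pi / p))"
    using nn_integral_exp_quadratic[OF assms, of 0] by simp
  also have "ennreal (sqrt (pi / p)) * (\<integral>\<^sup>+y. ennreal (exp (- q * y\<^sup>2)) \<partial>lborel) =
    (if q > 0 then ennreal (pi / sqrt (p * q)) else \<infinity>)"
  proof (cases "q > 0")
    case True
    then have "(\<integral>\<^sup>+y. ennreal (exp (- q * y\<^sup>2)) \<partial>lborel) = ennreal (sqrt (pi / q))"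
      using nn_integral_exp_quadratic[of q 0] by simp
    moreover have "sqrt (pi / p) * sqrt (pi / q) = pi / sqrt (p * q)"
      by (simp add: real_sqrt_divide real_sqrt_mult)
    ultimately show ?thesis
      using True assms by (simp only: ennreal_mult[symmetric] real_sqrt_ge_zero divide_nonneg_pos pi_ge_zero if_True)
  next
    case False
    then show ?thesis
      using assms nn_integral_exp_quadratic_infinite[of q] by (simp add: ennreal_mult_top)
  qed
  finally show ?thesis .
qed

lemma cmod_exp_square: "(cmod (exp z))\<^sup>2 = exp (2 * Re z)"
  by (simp add: power2_eq_square flip: exp_add)

text \<open>The factor \<open>Re (g * z\<^sup>2)\<close> common to both weights is absorbed into \<open>u\<close> by the
  holomorphic multiplier \<open>exp (- g * z\<^sup>2)\<close>. In the notation of the theorem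
  \<open>A = a + b\<close> and \<open>B = a - b\<close>, while the parameter \<open>\<beta>\<close> below is \<open>- \<gamma>\<close>.\<close>

locale normalized_weights =
  fixes \<Phi>1 \<Phi>2 :: "complex \<Rightarrow> real" and c g :: complex and A B :: real
  assumes c: "c \<noteq> 0" and A: "A > 0" and BA: "B \<le> A"
    and \<Phi>1: "\<And>z. \<Phi>1 (c * z) = (Re z)\<^sup>2 + (Im z)\<^sup>2 + Re (g * z\<^sup>2)"
    and \<Phi>2: "\<And>z. \<Phi>2 (c * z) = A * (Re z)\<^sup>2 + B * (Im z)\<^sup>2 + Re (g * z\<^sup>2)"
begin

lemma measurable_weights: "\<Phi>1 \<in> borel_measurable borel" "\<Phi>2 \<in> borel_measurable borel"
proof -
  have "\<Phi>1 = (\<lambda>z. (Re (z / c))\<^sup>2 + (Im (z / c))\<^sup>2 + Re (g * (z / c)\<^sup>2))"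
    using \<Phi>1[of "z / c" for z] c by auto
  then show "\<Phi>1 \<in> borel_measurable borel"
    using c by (auto intro!: borel_measurable_continuous_onI continuous_intros)
  have "\<Phi>2 = (\<lambda>z. A * (Re (z / c))\<^sup>2 + B * (Im (z / c))\<^sup>2 + Re (g * (z / c)\<^sup>2))"
    using \<Phi>2[of "z / c" for z] c by auto
  then show "\<Phi>2 \<in> borel_measurable borel"
    using c by (auto intro!: borel_measurable_continuous_onI continuous_intros)
qed

text \<open>The terms in \<open>g\<close> cancel and the difference is (A - 1) x^2 + (B - 1) y^2. As
  \<open>B \<le> A\<close>, the critical direction is the imaginary axis.\<close>

lemma weights_le_iff: "(\<forall>z. \<Phi>1 z \<le> \<Phi>2 z) \<longleftrightarrow> B \<ge> 1"
proof
  assume "\<forall>z. \<Phi>1 z \<le> \<Phi>2 z"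
  then have "\<Phi>1 (c * \<i>) \<le> \<Phi>2 (c * \<i>)" by blast
  then show "B \<ge> 1" by (simp add: \<Phi>1 \<Phi>2)
next
  assume B: "B \<ge> 1"
  have "\<Phi>1 (c * z) \<le> \<Phi>2 (c * z)" for z
    using B BA mult_right_mono[of 1 A "(Re z)\<^sup>2"] mult_right_mono[of 1 B "(Im z)\<^sup>2"]
    by (simp add: \<Phi>1 \<Phi>2)
  from this[of "z / c" for z] show "\<forall>z. \<Phi>1 z \<le> \<Phi>2 z"
    using c by simp
qed

text \<open>The exponential factor has squared modulus exp (2 \<beta> (x^2 - y^2) - 2 Re (g z^2)).
  It removes \<open>g\<close> from both weights and shifts their exponents by a free parameter
  \<beta>, in opposite directions in x and y, with one and the same \<open>f\<close>. The factor
  |c|^2 is the Jacobian of z -> c z.\<close>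

lemma energy_twist:
  fixes \<beta> :: real
  assumes u: "u holomorphic_on UNIV"
  defines "f \<equiv> \<lambda>z. u (c * z) * exp ((of_real \<beta> - g) * z\<^sup>2)"
  shows "f holomorphic_on UNIV"
    and "energy \<Phi>1 u = ennreal ((cmod c)\<^sup>2) *
      (\<integral>\<^sup>+z. ennreal ((cmod (f z))\<^sup>2 * exp (- (2 * (1 + \<beta>)) * (Re z)\<^sup>2 - 2 * (1 - \<beta>) * (Im z)\<^sup>2)) \<partial>lborel)"
    and "energy \<Phi>2 u = ennreal ((cmod c)\<^sup>2) *
      (\<integral>\<^sup>+z. ennreal ((cmod (f z))\<^sup>2 * exp (- (2 * (A + \<beta>)) * (Re z)\<^sup>2 - 2 * (B - \<beta>) * (Im z)\<^sup>2)) \<partial>lborel)"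
proof -
  note [measurable] = entire_borel_measurable[OF u] measurable_weights
  have "(\<lambda>z. u (c * z)) holomorphic_on UNIV"
    by (rule holomorphic_on_compose_gen[OF _ u, unfolded o_def]) (auto intro!: holomorphic_intros)
  then show "f holomorphic_on UNIV"
    unfolding f_def by (intro holomorphic_intros)
  have f2: "(cmod (f z))\<^sup>2 * exp t =
      (cmod (u (c * z)))\<^sup>2 * exp (2 * \<beta> * ((Re z)\<^sup>2 - (Im z)\<^sup>2) - 2 * Re (g * z\<^sup>2) + t)" for z t
    unfolding f_def norm_mult power_mult_distrib cmod_exp_square exp_add
    by (simp add: algebra_simps Re_power2)
  have e1: "exp (- 2 * \<Phi>1 (c * z)) = exp (2 * \<beta> * ((Re z)\<^sup>2 - (Im z)\<^sup>2) - 2 * Re (g * z\<^sup>2) +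
      (- (2 * (1 + \<beta>)) * (Re z)\<^sup>2 - 2 * (1 - \<beta>) * (Im z)\<^sup>2))" for z
    unfolding \<Phi>1 by (simp add: algebra_simps)
  have e2: "exp (- 2 * \<Phi>2 (c * z)) = exp (2 * \<beta> * ((Re z)\<^sup>2 - (Im z)\<^sup>2) - 2 * Re (g * z\<^sup>2) +
      (- (2 * (A + \<beta>)) * (Re z)\<^sup>2 - 2 * (B - \<beta>) * (Im z)\<^sup>2))" for z
    unfolding \<Phi>2 by (simp add: algebra_simps)
  have "energy \<Phi> u = ennreal ((cmod c)\<^sup>2) *
      (\<integral>\<^sup>+z. ennreal ((cmod (u (c * z)))\<^sup>2 * exp (- 2 * \<Phi> (c * z))) \<partial>lborel)"
    if [measurable]: "\<Phi> \<in> borel_measurable borel" for \<Phi>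
    unfolding energy_def by (rule nn_integral_complex_mult) (use c in simp_all)
  note this[OF measurable_weights(1)] this[OF measurable_weights(2)]
  then show "energy \<Phi>1 u = ennreal ((cmod c)\<^sup>2) *
      (\<integral>\<^sup>+z. ennreal ((cmod (f z))\<^sup>2 * exp (- (2 * (1 + \<beta>)) * (Re z)\<^sup>2 - 2 * (1 - \<beta>) * (Im z)\<^sup>2)) \<partial>lborel)"
    and "energy \<Phi>2 u = ennreal ((cmod c)\<^sup>2) *
      (\<integral>\<^sup>+z. ennreal ((cmod (f z))\<^sup>2 * exp (- (2 * (A + \<beta>)) * (Re z)\<^sup>2 - 2 * (B - \<beta>) * (Im z)\<^sup>2)) \<partial>lborel)"
    by (simp_all only: f2 e1 e2)
qed

text \<open>\<open>P\<close> and \<open>R\<close> require, in x and in y respectively, that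
  convolving the shifted weight of \<open>\<Phi>2\<close> with exp (- S |w|^2) gives a multiple of
  the shifted weight of \<open>\<Phi>1\<close>.\<close>

lemma energy_le:
  fixes \<beta> S :: real
  assumes u: "u holomorphic_on UNIV"
    and S: "S > 0" "2 * (A + \<beta>) + S > 0" "2 * (B - \<beta>) + S > 0"
    and P: "2 * (A + \<beta>) * S = 2 * (1 + \<beta>) * (2 * (A + \<beta>) + S)"
    and R: "2 * (B - \<beta>) * S = 2 * (1 - \<beta>) * (2 * (B - \<beta>) + S)"
  shows "energy \<Phi>2 u \<le> ennreal (S / sqrt ((2 * (A + \<beta>) + S) * (2 * (B - \<beta>) + S))) * energy \<Phi>1 u"
proof -
  have *: "2 * (A + \<beta>) * S / (2 * (A + \<beta>) + S) = 2 * (1 + \<beta>)"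
    "2 * (B - \<beta>) * S / (2 * (B - \<beta>) + S) = 2 * (1 - \<beta>)"
    unfolding P R using S by simp_all
  show ?thesis
    unfolding energy_twist(2,3)[OF u, of \<beta>]
    using mult_left_mono[OF gaussian_weight_monotone[OF energy_twist(1)[OF u, of \<beta>] S, unfolded *], of "ennreal ((cmod c)\<^sup>2)"]
    by (simp add: mult_ac)
qed

text \<open>The function \<open>u\<close> whose twist \<open>f\<close> in
  \<open>energy_twist\<close> is identically 1.\<close>

definition test_gaussian :: "real \<Rightarrow> complex \<Rightarrow> complex" where
  "test_gaussian \<beta> z = exp ((g - of_real \<beta>) * (z / c)\<^sup>2)"

lemma holomorphic_test_gaussian: "test_gaussian \<beta> holomorphic_on UNIV"
  unfolding test_gaussian_def[abs_def] using c by (intro holomorphic_intros) auto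

text \<open>With \<open>f = 1\<close> both energies are pure Gaussian integrals. The one for
  \<open>\<Phi>2\<close> diverges as soon as its exponent in y, \<open>2 * (B - \<beta>)\<close>, is
  not positive; this is what refutes boundedness for \<open>B < 1\<close>.\<close>

lemma energy_test_gaussian:
  assumes "0 \<le> \<beta>" "\<beta> < 1"
  shows "energy \<Phi>1 (test_gaussian \<beta>) = ennreal ((cmod c)\<^sup>2 * pi / (2 * sqrt (1 - \<beta>\<^sup>2)))"
    and "energy \<Phi>2 (test_gaussian \<beta>) =
      (if \<beta> < B then ennreal ((cmod c)\<^sup>2 * pi / (2 * sqrt ((A + \<beta>) * (B - \<beta>)))) else \<infinity>)"
proof -
  have one: "test_gaussian \<beta> (c * z) * exp ((of_real \<beta> - g) * z\<^sup>2) = 1" for z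
    using c by (simp add: test_gaussian_def algebra_simps flip: exp_add)
  note tw = energy_twist(2,3)[OF holomorphic_test_gaussian, of \<beta> \<beta>, unfolded one norm_one power_one mult_1_left]
  have s: "sqrt (2 * x * (2 * y)) = 2 * sqrt (x * y)" for x y
    using real_sqrt_mult[of 4 "x * y"] by (simp add: mult_ac)
  have eq: "(1 + \<beta>) * (1 - \<beta>) = 1 - \<beta>\<^sup>2"
    by (simp add: algebra_simps power2_eq_square)
  have "\<beta>\<^sup>2 \<le> 1"
    using assms by (simp add: abs_square_le_1)
  have pos: "2 * (1 + \<beta>) > 0" "2 * (1 - \<beta>) > 0" "2 * (A + \<beta>) > 0"
    using assms A by auto
  show "energy \<Phi>1 (test_gaussian \<beta>) = ennreal ((cmod c)\<^sup>2 * pi / (2 * sqrt (1 - \<beta>\<^sup>2)))"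
    unfolding tw nn_integral_anisotropic_gaussian[OF pos(1)] s eq
    using pos(2) \<open>\<beta>\<^sup>2 \<le> 1\<close> by (simp flip: ennreal_mult)
  have "ennreal ((cmod c)\<^sup>2) * top = top"
    using c by (simp add: ennreal_mult_top)
  then show "energy \<Phi>2 (test_gaussian \<beta>) =
      (if \<beta> < B then ennreal ((cmod c)\<^sup>2 * pi / (2 * sqrt ((A + \<beta>) * (B - \<beta>)))) else \<infinity>)"
    unfolding tw nn_integral_anisotropic_gaussian[OF pos(3)] s
    using pos(3) by (simp flip: ennreal_mult)
qed

lemma test_gaussian_in_H_space:
  assumes "0 \<le> \<beta>" "\<beta> < 1"
  shows "test_gaussian \<beta> \<in> H_space \<Phi>1"
  using energy_test_gaussian(1)[OF assms] holomorphic_test_gaussian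
  by (simp add: H_space_iff_energy measurable_weights)

lemma not_bounded:
  assumes "B < 1"
  shows "\<not> embedding_bounded \<Phi>1 \<Phi>2"
proof
  assume "embedding_bounded \<Phi>1 \<Phi>2"
  then have sub: "H_space \<Phi>1 \<subseteq> H_space \<Phi>2"
    by (auto simp: embedding_bounded_def embedding_domain_def)
  \<comment> \<open>The exponent \<open>max 0 B\<close> lies in [0, 1), so its Gaussian is in the
    first space, and it is at least \<open>B\<close>, so the second energy is infinite.\<close>
  have \<beta>: "0 \<le> max 0 B" "max 0 B < 1" using assms by auto
  from energy_test_gaussian(2)[OF this] test_gaussian_in_H_space[OF this] sub show False
    by (auto simp: H_space_iff_energy measurable_weights)
qed

lemma ratio_test_gaussian:
  assumes "0 \<le> \<beta>" "\<beta> < 1" "\<beta> < B"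
  shows "H_norm \<Phi>2 (test_gaussian \<beta>) / H_norm \<Phi>1 (test_gaussian \<beta>) =
    sqrt (sqrt ((1 - \<beta>\<^sup>2) / ((A + \<beta>) * (B - \<beta>))))"
proof -
  have pos: "1 - \<beta>\<^sup>2 > 0" "(A + \<beta>) * (B - \<beta>) > 0"
    using assms A by (auto simp: abs_square_less_1)
  have "H_norm \<Phi>2 (test_gaussian \<beta>) / H_norm \<Phi>1 (test_gaussian \<beta>) =
    sqrt (((cmod c)\<^sup>2 * pi / (2 * sqrt ((A + \<beta>) * (B - \<beta>)))) / ((cmod c)\<^sup>2 * pi / (2 * sqrt (1 - \<beta>\<^sup>2))))"
    unfolding H_norm_eq_energy[OF measurable_weights(1) holomorphic_test_gaussian]
      H_norm_eq_energy[OF measurable_weights(2) holomorphic_test_gaussian]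
      energy_test_gaussian[OF assms(1,2)] real_sqrt_divide[symmetric]
    using assms(3) pos by simp
  also have "((cmod c)\<^sup>2 * pi / (2 * sqrt ((A + \<beta>) * (B - \<beta>)))) / ((cmod c)\<^sup>2 * pi / (2 * sqrt (1 - \<beta>\<^sup>2)))
     = sqrt ((1 - \<beta>\<^sup>2) / ((A + \<beta>) * (B - \<beta>)))"
    using c by (simp add: real_sqrt_divide)
  finally show ?thesis .
qed

text \<open>The hypothesis \<open>stat\<close> says that one and the same \<open>S\<close> fits both coordinates in
  \<open>energy_le\<close>; it is also the critical point equation for the ratios of the test Gaussians.\<close>

lemma norm_stationary:
  assumes B: "B > 1" and \<beta>: "0 \<le> \<beta>" "\<beta> < 1"
    and stat: "(A - 1) * ((1 - \<beta>) * (B - \<beta>)) = (B - 1) * ((1 + \<beta>) * (A + \<beta>))"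
  shows "embedding_bounded \<Phi>1 \<Phi>2"
    and "embedding_norm \<Phi>1 \<Phi>2 = sqrt (sqrt ((1 - \<beta>\<^sup>2) / ((A + \<beta>) * (B - \<beta>))))"
proof -
  \<comment> \<open>This solves the equation for x in \<open>energy_le\<close>: 1 / S = 1 / (2 (1 +
    \<beta>)) - 1 / (2 (A + \<beta>)).\<close>
  define S where "S = 2 * (1 + \<beta>) * (A + \<beta>) / (A - 1)"
  have A1: "A > 1" using B BA by simp
  have S: "S > 0" "2 * (A + \<beta>) + S > 0" "2 * (B - \<beta>) + S > 0"
    using A1 \<beta> B by (auto simp: S_def intro!: add_pos_pos divide_pos_pos mult_pos_pos add_nonneg_pos add_pos_nonneg)
  \<comment> \<open>The equation for y prescribes its own value of \<open>S\<close>;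
    \<open>stat\<close> says that the two agree.\<close>
  have S': "S = 2 * (1 - \<beta>) * (B - \<beta>) / (B - 1)"
    unfolding S_def using stat A1 B by (simp add: field_simps)
  have cancel: "2 * y + 2 * x * y / d = 2 * x * y / d * y / x"
    if "x \<noteq> 0" "d \<noteq> 0" "y = d + x" for x y d :: real
  proof -
    have "2 * x * y / d * y / x = 2 * y * (d + x) / d"
      using that(1) by (simp flip: that(3))
    also have "\<dots> = 2 * y + 2 * x * y / d"
      using that(2) by (simp add: add_divide_distrib ring_distribs mult_ac)
    finally show ?thesis by simp
  qed
  have P: "2 * (A + \<beta>) + S = S * (A + \<beta>) / (1 + \<beta>)"
    unfolding S_def by (rule cancel) (use A1 \<beta> in simp_all)
  have R: "2 * (B - \<beta>) + S = S * (B - \<beta>) / (1 - \<beta>)"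
    unfolding S' by (rule cancel) (use B \<beta> in simp_all)
  \<comment> \<open>By \<open>P\<close> and \<open>R\<close> each factor under the root is
    \<open>S\<close> times a ratio, so \<open>S\<close> cancels and (1 + \<beta>) (1 - \<beta>)
    gives the numerator.\<close>
  have K: "S / sqrt ((2 * (A + \<beta>) + S) * (2 * (B - \<beta>) + S)) = sqrt ((1 - \<beta>\<^sup>2) / ((A + \<beta>) * (B - \<beta>)))"
  proof -
    have "(2 * (A + \<beta>) + S) * (2 * (B - \<beta>) + S) = S\<^sup>2 * ((A + \<beta>) * (B - \<beta>) / (1 - \<beta>\<^sup>2))"
      unfolding P R by (simp add: power2_eq_square algebra_simps)
    then have "sqrt ((2 * (A + \<beta>) + S) * (2 * (B - \<beta>) + S)) = S * sqrt ((A + \<beta>) * (B - \<beta>) / (1 - \<beta>\<^sup>2))"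
      using S(1) by (simp only: real_sqrt_mult real_sqrt_abs abs_of_pos)
    then show ?thesis
      using S(1) by (simp add: real_sqrt_divide)
  qed
  have le: "energy \<Phi>2 u \<le> ennreal (sqrt ((1 - \<beta>\<^sup>2) / ((A + \<beta>) * (B - \<beta>)))) * energy \<Phi>1 u"
    if "u holomorphic_on UNIV" for u
  proof -
    have cancel': "2 * y * S = 2 * x * (S * y / x)" if "x \<noteq> 0" for x y :: real
      using that by simp
    have "2 * (A + \<beta>) * S = 2 * (1 + \<beta>) * (2 * (A + \<beta>) + S)"
      unfolding P by (rule cancel') (use \<beta> in simp)
    moreover have "2 * (B - \<beta>) * S = 2 * (1 - \<beta>) * (2 * (B - \<beta>) + S)"
      unfolding R by (rule cancel') (use \<beta> in simp)
    ultimately show ?thesis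
      using energy_le[OF that S] by (simp only: K)
  qed
  then have le': "\<forall>u. u holomorphic_on UNIV \<longrightarrow>
      energy \<Phi>2 u \<le> ennreal (sqrt ((1 - \<beta>\<^sup>2) / ((A + \<beta>) * (B - \<beta>)))) * energy \<Phi>1 u"
    by blast
  have K0: "0 \<le> sqrt ((1 - \<beta>\<^sup>2) / ((A + \<beta>) * (B - \<beta>)))"
    using \<beta> A B by (auto intro!: divide_nonneg_nonneg mult_nonneg_nonneg simp: abs_square_le_1)
  show "embedding_bounded \<Phi>1 \<Phi>2"
    by (rule embedding_bounded_by_energy(3)[OF measurable_weights K0 le'])
  \<comment> \<open>The energy estimate bounds the norm from above, and the quotient at
    \<open>test_gaussian \<beta>\<close> attains this bound.\<close>
  show "embedding_norm \<Phi>1 \<Phi>2 = sqrt (sqrt ((1 - \<beta>\<^sup>2) / ((A + \<beta>) * (B - \<beta>))))"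
    using embedding_norm_bounds(1)[OF measurable_weights K0 le']
      embedding_norm_bounds(2)[OF measurable_weights K0 le' test_gaussian_in_H_space[OF \<beta>]]
      ratio_test_gaussian[OF \<beta>] \<beta> B by fastforce
qed

text \<open>Here the extremal exponent is \<open>\<beta> = 1\<close>, whose Gaussian is not in the space, so the
  supremum is only approached as \<open>\<beta>\<close> tends to 1.\<close>

lemma norm_degenerate:
  assumes B: "B = 1"
  shows "embedding_bounded \<Phi>1 \<Phi>2"
    and "embedding_norm \<Phi>1 \<Phi>2 = sqrt (sqrt (2 / (A + 1)))"
proof -
  have le: "energy \<Phi>2 u \<le> ennreal (sqrt (2 / (A + 1))) * energy \<Phi>1 u"
    if u: "u holomorphic_on UNIV" for u
  proof (cases "A = 1")
    \<comment> \<open>Both weights coincide and the constant is 1. The case is split off because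
      \<open>S\<close> below divides by \<open>A - 1\<close>.\<close>
    case True
    then show ?thesis
      using B by (simp add: energy_twist(2,3)[OF u, of 0])
  next
    case False
    then have A1: "A > 1" using B BA by simp
    \<comment> \<open>The \<open>S\<close> of \<open>norm_stationary\<close> at \<beta> = 1. Since
      \<open>B = 1\<close>, both shifted exponents in y vanish there, so the equation for y holds
      for every \<open>S\<close>.\<close>
    define S where "S = 4 * (A + 1) / (A - 1)"
    have S: "S > 0" "2 * (A + 1) + S > 0"
      using A1 by (auto simp: S_def intro!: add_pos_pos divide_pos_pos)
    have P: "2 * (A + 1) + S = S * (A + 1) / 2"
      using A1 by (simp add: S_def field_simps)
    have K: "S / sqrt ((2 * (A + 1) + S) * (2 * (B - 1) + S)) = sqrt (2 / (A + 1))"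
    proof -
      have "(2 * (A + 1) + S) * (2 * (B - 1) + S) = S\<^sup>2 * ((A + 1) / 2)"
        unfolding P B by (simp add: power2_eq_square)
      then have "sqrt ((2 * (A + 1) + S) * (2 * (B - 1) + S)) = S * sqrt ((A + 1) / 2)"
        using S(1) by (simp only: real_sqrt_mult real_sqrt_abs abs_of_pos)
      then show ?thesis
        using S(1) by (simp add: real_sqrt_divide)
    qed
    have "2 * (A + 1) * S = 2 * (1 + 1) * (2 * (A + 1) + S)"
      unfolding P by simp
    then show ?thesis
      using energy_le[OF u S] S(1) unfolding K by (simp add: B)
  qed
  then have le': "\<forall>u. u holomorphic_on UNIV \<longrightarrow>
      energy \<Phi>2 u \<le> ennreal (sqrt (2 / (A + 1))) * energy \<Phi>1 u"
    by blast
  have K0: "0 \<le> sqrt (2 / (A + 1))" using A by simp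
  show "embedding_bounded \<Phi>1 \<Phi>2"
    by (rule embedding_bounded_by_energy(3)[OF measurable_weights K0 le'])
  \<comment> \<open>For \<open>B = 1\<close> the factor 1 - \<beta> cancels from 1 - \<beta>^2 and
    \<open>B - \<beta>\<close>, so the ratio has a finite limit at \<beta> = 1.\<close>
  have ge: "sqrt (sqrt ((1 + \<beta>) / (A + \<beta>))) \<le> embedding_norm \<Phi>1 \<Phi>2" if \<beta>: "0 \<le> \<beta>" "\<beta> < 1" for \<beta>
  proof -
    have "(1 - \<beta>\<^sup>2) / ((A + \<beta>) * (B - \<beta>)) = (1 + \<beta>) * (1 - \<beta>) / ((A + \<beta>) * (1 - \<beta>))"
      by (simp add: B power2_eq_square algebra_simps)
    also have "\<dots> = (1 + \<beta>) / (A + \<beta>)"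
      using \<beta> by simp
    finally show ?thesis
      using embedding_norm_bounds(2)[OF measurable_weights K0 le' test_gaussian_in_H_space[OF \<beta>]]
        ratio_test_gaussian[OF \<beta>] \<beta> B by simp
  qed
  have "((\<lambda>\<beta>. sqrt (sqrt ((1 + \<beta>) / (A + \<beta>)))) \<longlongrightarrow> sqrt (sqrt ((1 + 1) / (A + 1)))) (at_left 1)"
    using A by (intro tendsto_intros) auto
  moreover have "eventually (\<lambda>\<beta>. sqrt (sqrt ((1 + \<beta>) / (A + \<beta>))) \<le> embedding_norm \<Phi>1 \<Phi>2) (at_left 1)"
    unfolding eventually_at_left[of 0 1, OF zero_less_one] using ge by (intro exI[of _ 0]) auto
  ultimately have "sqrt (sqrt ((1 + 1) / (A + 1))) \<le> embedding_norm \<Phi>1 \<Phi>2"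
    by (rule tendsto_upperbound) simp
  then show "embedding_norm \<Phi>1 \<Phi>2 = sqrt (sqrt (2 / (A + 1)))"
    using embedding_norm_bounds(1)[OF measurable_weights K0 le'] by simp
qed

end

section \<open>Quadratic forms brought to normal form\<close>

lemma real_quadratic_diff:
  assumes "real_quadratic \<Phi>1" "real_quadratic \<Phi>2"
  shows "real_quadratic (\<lambda>z. \<Phi>2 z - \<Phi>1 z)"
proof -
  obtain p q r p' q' r' where "\<And>z. \<Phi>1 z = p * (Re z)\<^sup>2 + q * Re z * Im z + r * (Im z)\<^sup>2"
    "\<And>z. \<Phi>2 z = p' * (Re z)\<^sup>2 + q' * Re z * Im z + r' * (Im z)\<^sup>2"
    using assms unfolding real_quadratic_def by metis
  then have "\<Phi>2 z - \<Phi>1 z = (p' - p) * (Re z)\<^sup>2 + (q' - q) * Re z * Im z + (r' - r) * (Im z)\<^sup>2" for z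
    by (simp add: algebra_simps)
  then show ?thesis unfolding real_quadratic_def by blast
qed

text \<open>Expansion in z and \<open>cnj z\<close>: the Levi constant is the coefficient of |z|^2,
  and the two conjugate terms, each with half a second derivative, combine to one real part. The
  point \<open>w\<close> is arbitrary because the derivatives are constant.\<close>

lemma real_quadratic_normal_form:
  assumes "real_quadratic \<Phi>"
  shows "\<Phi> z = levi \<Phi> w * (cmod z)\<^sup>2 + Re (holo_hessian \<Phi> w * z\<^sup>2)"
proof -
  obtain p q r where *: "\<And>z. \<Phi> z = p * (Re z)\<^sup>2 + q * Re z * Im z + r * (Im z)\<^sup>2"
    using assms unfolding real_quadratic_def by metis
  show ?thesis
    unfolding mixed_wirtinger_quadratic(2,3)[OF *]
    by (simp add: * cmod_power2 Re_power2 Im_power2 field_simps)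
qed

lemma levi_diff:
  assumes "real_quadratic \<Phi>1" "real_quadratic \<Phi>2"
  shows "levi (\<lambda>z. \<Phi>2 z - \<Phi>1 z) w = levi \<Phi>2 w - levi \<Phi>1 w"
proof -
  obtain p q r p' q' r' where *: "\<And>z. \<Phi>1 z = p * (Re z)\<^sup>2 + q * Re z * Im z + r * (Im z)\<^sup>2"
    "\<And>z. \<Phi>2 z = p' * (Re z)\<^sup>2 + q' * Re z * Im z + r' * (Im z)\<^sup>2"
    using assms unfolding real_quadratic_def by metis
  then have "\<Phi>2 z - \<Phi>1 z = (p' - p) * (Re z)\<^sup>2 + (q' - q) * Re z * Im z + (r' - r) * (Im z)\<^sup>2" for z
    by (simp add: algebra_simps)
  from mixed_wirtinger_quadratic(2)[OF this, of w] show ?thesis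
    unfolding mixed_wirtinger_quadratic(2)[OF *(1)] mixed_wirtinger_quadratic(2)[OF *(2)]
    by (simp add: field_simps)
qed

text \<open>A dilation makes the Levi constant of \<open>\<Phi>1\<close> equal to 1, and a rotation
  makes the Hessian of the difference the nonnegative number \<open>b\<close>. The transformed
  Hessian of \<open>\<Phi>1\<close> is what remains as \<open>g\<close> in both weights.\<close>

lemma normalized_weights_exist:
  fixes \<Phi>1 \<Phi>2 :: "complex \<Rightarrow> real" and w :: complex and a b :: real
  assumes quadratic: "real_quadratic \<Phi>1" "real_quadratic \<Phi>2"
    and psh: "strictly_plurisubharmonic \<Phi>1" "strictly_plurisubharmonic \<Phi>2"
    and a: "a = levi \<Phi>2 w / levi \<Phi>1 w"
    and b: "b = cmod (holo_hessian (\<lambda>z. \<Phi>2 z - \<Phi>1 z) w) / levi \<Phi>1 w"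
  shows "\<exists>c g. normalized_weights \<Phi>1 \<Phi>2 c g (a + b) (a - b)"
proof -
  define l h k where "l = levi \<Phi>1 w" and "h = holo_hessian \<Phi>1 w"
    and "k = holo_hessian (\<lambda>z. \<Phi>2 z - \<Phi>1 z) w"
  have l: "l > 0" and l2: "levi \<Phi>2 w = a * l" "levi \<Phi>2 w > 0" and bl: "b = cmod k / l"
    using psh by (auto simp: l_def k_def strictly_plurisubharmonic_def a b less_imp_neq[symmetric])
  have a0: "a > 0" and b0: "b \<ge> 0"
    using l l2 bl by (auto simp: zero_less_mult_iff)
  have \<Phi>1: "\<Phi>1 z = l * (cmod z)\<^sup>2 + Re (h * z\<^sup>2)" for z
    unfolding l_def h_def by (rule real_quadratic_normal_form[OF quadratic(1)])
  have \<Phi>2: "\<Phi>2 z = a * l * (cmod z)\<^sup>2 + Re (h * z\<^sup>2) + Re (k * z\<^sup>2)" for z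
    using real_quadratic_normal_form[OF real_quadratic_diff[OF quadratic], of z w] \<Phi>1[of z]
    by (simp add: levi_diff[OF quadratic] l2 algebra_simps flip: l_def k_def)
  \<comment> \<open>The square of \<open>c\<close> has modulus \<open>1 / l\<close> and the phase
    opposite to that of \<open>k\<close>. For \<open>k = 0\<close> any phase works, but
    \<open>sgn 0 = 0\<close> would make \<open>c\<close> vanish.\<close>
  define c where "c = csqrt ((if k = 0 then 1 else cnj (sgn k)) / of_real l)"
  have c2: "c\<^sup>2 = (if k = 0 then 1 else cnj (sgn k)) / of_real l"
    by (simp add: c_def)
  then have n: "(cmod c)\<^sup>2 = 1 / l"
    using l by (simp add: norm_power[symmetric] norm_divide norm_sgn)
  have kc: "k * c\<^sup>2 = of_real b"
  proof (cases "k = 0")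
    case False
    have "k * cnj k = of_real ((cmod k)\<^sup>2)"
      by (rule complex_norm_square[symmetric])
    then have "k * cnj (sgn k) = of_real (cmod k)"
      using False by (simp add: sgn_div_norm scaleR_conv_of_real field_simps power2_eq_square)
    then show ?thesis
      using False by (simp add: c2 bl)
  qed (simp add: bl)
  have "normalized_weights \<Phi>1 \<Phi>2 c (h * c\<^sup>2) (a + b) (a - b)"
  proof
    show "c \<noteq> 0" using n l by auto
    show "a + b > 0" "a - b \<le> a + b" using a0 b0 by auto
    fix z
    have 1: "l * (cmod (c * z))\<^sup>2 = (Re z)\<^sup>2 + (Im z)\<^sup>2"
      using l by (simp add: norm_mult power_mult_distrib n flip: cmod_power2)
    have 2: "h * (c * z)\<^sup>2 = h * c\<^sup>2 * z\<^sup>2"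
      by (simp add: power_mult_distrib)
    have 3: "Re (k * (c * z)\<^sup>2) = b * ((Re z)\<^sup>2 - (Im z)\<^sup>2)"
      unfolding power_mult_distrib mult.assoc[symmetric] kc by (simp add: Re_power2)
    show "\<Phi>1 (c * z) = (Re z)\<^sup>2 + (Im z)\<^sup>2 + Re (h * c\<^sup>2 * z\<^sup>2)"
      unfolding \<Phi>1 1 2 ..
    show "\<Phi>2 (c * z) = (a + b) * (Re z)\<^sup>2 + (a - b) * (Im z)\<^sup>2 + Re (h * c\<^sup>2 * z\<^sup>2)"
      unfolding \<Phi>2 mult.assoc[of a] 1 2 3 by (simp add: algebra_simps)
  qed
  then show ?thesis by blast
qed

section \<open>The stationary exponent and the case distinction\<close>

lemma sqrt_sqrt_powr: "x \<ge> 0 \<Longrightarrow> sqrt (sqrt x) = x powr (1 / 4)"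
  by (simp add: powr_half_sqrt[symmetric] powr_powr)

text \<open>The last equation expands to twice b \<gamma>^2 + m \<gamma> + b = 0 with m = a^2 - b^2
  - 1. The roots are negative with product 1, and \<gamma> is the larger one, hence in (-1,
  0).\<close>

lemma stationary_exponent:
  fixes a b :: real
  assumes b: "b > 0" and ab: "a - b > 1"
  defines "\<gamma> \<equiv> 1 / (2 * b) * (1 - a\<^sup>2 + b\<^sup>2 + sqrt ((a\<^sup>2 - b\<^sup>2 - 1)\<^sup>2 - 4 * b\<^sup>2))"
  shows "0 \<le> - \<gamma>" "- \<gamma> < 1"
    and "(a + b - 1) * ((1 + \<gamma>) * (a - b + \<gamma>)) = (a - b - 1) * ((1 - \<gamma>) * (a + b - \<gamma>))"
proof -
  define m where "m = a\<^sup>2 - b\<^sup>2 - 1"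
  define s where "s = sqrt (m\<^sup>2 - 4 * b\<^sup>2)"
  \<comment> \<open>The condition \<open>a - b > 1\<close> gives \<open>m > 2 * b\<close>, so the
    two roots are real and distinct.\<close>
  have "(1 + b)\<^sup>2 < a\<^sup>2"
    using assms by (intro power_strict_mono) auto
  then have m: "m > 2 * b"
    by (simp add: m_def power2_eq_square algebra_simps)
  have d: "m\<^sup>2 - 4 * b\<^sup>2 > 0"
    using power_strict_mono[OF m, of 2] b by (simp add: power_mult_distrib)
  have s2: "s\<^sup>2 = m\<^sup>2 - 4 * b\<^sup>2" and s0: "s > 0"
    using d by (auto simp: s_def)
  have \<gamma>: "2 * b * \<gamma> = s - m"
    using b by (simp add: \<gamma>_def s_def m_def)
  have sm: "s < m"
    by (rule power_less_imp_less_base[of _ 2]) (use s2 b m in auto)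
  then have "2 * b * \<gamma> < 0" using \<gamma> by simp
  then show "0 \<le> - \<gamma>" using b by (simp add: mult_less_0_iff)
  \<comment> \<open>Since \<open>2 * b * \<gamma> = s - m\<close>, the bound \<gamma> > -1 says
    \<open>m - 2 * b < s\<close>.\<close>
  have "(m - 2 * b)\<^sup>2 < s\<^sup>2"
  proof -
    have "s\<^sup>2 - (m - 2 * b)\<^sup>2 = 4 * b * (m - 2 * b)"
      unfolding s2 by (simp add: power2_eq_square algebra_simps)
    also have "\<dots> > 0" using b m by simp
    finally show ?thesis by simp
  qed
  then have "m - 2 * b < s"
    by (rule power_less_imp_less_base) (use s0 in simp)
  then have "2 * b * (- \<gamma>) < 2 * b * 1" using \<gamma> by simp
  then show "- \<gamma> < 1" using b by (simp only: mult_less_cancel_left_pos)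
  have "(2 * b * \<gamma> + m)\<^sup>2 = m\<^sup>2 - 4 * b\<^sup>2"
    using s2 \<gamma> by simp
  then have "4 * b * (b * \<gamma>\<^sup>2 + m * \<gamma> + b) = 0"
    by (simp add: power2_eq_square algebra_simps)
  then have "b * \<gamma>\<^sup>2 + m * \<gamma> + b = 0" using b by simp
  then show "(a + b - 1) * ((1 + \<gamma>) * (a - b + \<gamma>)) = (a - b - 1) * ((1 - \<gamma>) * (a + b - \<gamma>))"
    unfolding m_def by algebra
qed

theorem theorem1p2:
  fixes \<Phi>1 \<Phi>2 :: "complex \<Rightarrow> real" and w :: complex and a b :: real
  assumes quadratic: "real_quadratic \<Phi>1" "real_quadratic \<Phi>2"
    and psh: "strictly_plurisubharmonic \<Phi>1" "strictly_plurisubharmonic \<Phi>2"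
    and a: "a = levi \<Phi>2 w / levi \<Phi>1 w"
    and b: "b = cmod (holo_hessian (\<lambda>z. \<Phi>2 z - \<Phi>1 z) w) / levi \<Phi>1 w"
  shows "(embedding_bounded \<Phi>1 \<Phi>2 \<longleftrightarrow> a - b \<ge> 1) \<and>
    (a - b \<ge> 1 \<longleftrightarrow> (\<forall>z. \<Phi>1 z \<le> \<Phi>2 z)) \<and>
    (a - b \<ge> 1 \<longrightarrow>
      (b = 0 \<longrightarrow> embedding_norm \<Phi>1 \<Phi>2 = a powr (- 1 / 2)) \<and>
      (a - b = 1 \<and> b > 0 \<longrightarrow> embedding_norm \<Phi>1 \<Phi>2 = a powr (- 1 / 4)) \<and>
      (a - b > 1 \<and> b > 0 \<longrightarrow>
        (let \<gamma> = 1 / (2 * b) * (1 - a\<^sup>2 + b\<^sup>2 + sqrt ((a\<^sup>2 - b\<^sup>2 - 1)\<^sup>2 - 4 * b\<^sup>2))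
         in embedding_norm \<Phi>1 \<Phi>2 = ((1 - \<gamma>\<^sup>2) / (a\<^sup>2 - (b - \<gamma>)\<^sup>2)) powr (1 / 4))))"
proof -
  obtain c g where "normalized_weights \<Phi>1 \<Phi>2 c g (a + b) (a - b)"
    using normalized_weights_exist[OF assms] by blast
  then interpret normalized_weights \<Phi>1 \<Phi>2 c g "a + b" "a - b" .
  have b0: "b \<ge> 0" using BA by simp
  \<comment> \<open>Stated for any stationary \<gamma> = - \<beta>, so that \<gamma> = 0 serves the
    case \<open>b = 0\<close>, where the explicit formula would divide by zero.\<close>
  have stationary: "embedding_bounded \<Phi>1 \<Phi>2" "embedding_norm \<Phi>1 \<Phi>2 = ((1 - \<gamma>\<^sup>2) / (a\<^sup>2 - (b - \<gamma>)\<^sup>2)) powr (1 / 4)"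
    if ab: "a - b > 1" and \<gamma>: "0 \<le> - \<gamma>" "- \<gamma> < 1"
      and st: "(a + b - 1) * ((1 + \<gamma>) * (a - b + \<gamma>)) = (a - b - 1) * ((1 - \<gamma>) * (a + b - \<gamma>))" for \<gamma>
  proof -
    have \<gamma>2: "\<gamma>\<^sup>2 \<le> 1" using \<gamma> by (simp add: abs_square_le_1)
    have eq: "(a + b + - \<gamma>) * (a - b - - \<gamma>) = a\<^sup>2 - (b - \<gamma>)\<^sup>2"
      by (simp add: power2_eq_square algebra_simps)
    have "a\<^sup>2 - (b - \<gamma>)\<^sup>2 \<ge> 0"
      unfolding eq[symmetric] using ab \<gamma> b0 by (intro mult_nonneg_nonneg) auto
    with norm_stationary[of "- \<gamma>"] ab \<gamma> st \<gamma>2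
    show "embedding_bounded \<Phi>1 \<Phi>2" "embedding_norm \<Phi>1 \<Phi>2 = ((1 - \<gamma>\<^sup>2) / (a\<^sup>2 - (b - \<gamma>)\<^sup>2)) powr (1 / 4)"
      unfolding eq by (simp_all add: sqrt_sqrt_powr)
  qed
  have degenerate: "embedding_norm \<Phi>1 \<Phi>2 = a powr (- 1 / 4)" if ab: "a - b = 1"
  proof -
    \<comment> \<open>From \<open>a - b = 1\<close> it follows that A + 1 = a + b + 1 = 2 a.\<close>
    have "embedding_norm \<Phi>1 \<Phi>2 = sqrt (sqrt (2 / (2 * a)))"
      using norm_degenerate(2)[OF ab] ab by (simp add: algebra_simps)
    also have "\<dots> = (1 / a) powr (1 / 4)"
      using ab b0 by (simp add: sqrt_sqrt_powr)
    also have "\<dots> = a powr (- 1 / 4)"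
      using ab b0 by (simp add: powr_divide powr_minus_divide)
    finally show ?thesis .
  qed
  have bounded: "embedding_bounded \<Phi>1 \<Phi>2" if ab: "a - b \<ge> 1"
  proof -
    consider "a - b = 1" | "a - b > 1" "b = 0" | "a - b > 1" "b > 0" using ab b0 by (metis order_le_less)
    then show ?thesis
    proof cases
      case 1 then show ?thesis by (rule norm_degenerate(1))
    next
      \<comment> \<open>For \<open>b = 0\<close> and \<gamma> = 0 both sides of the stationarity
        equation equal (a - 1) a.\<close>
      case 2 then show ?thesis using stationary(1)[of 0] by simp
    next
      case 3 then show ?thesis using stationary(1) stationary_exponent by blast
    qed
  qed
  have "embedding_bounded \<Phi>1 \<Phi>2 \<longleftrightarrow> a - b \<ge> 1"
    using bounded not_bounded by force
  \<comment> \<open>For \<open>b = 0\<close> the value \<open>a = 1\<close> falls under the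
    degenerate case; for \<open>a > 1\<close> the choice \<gamma> = 0 gives (1 / a^2)^(1/4).\<close>
  moreover have "embedding_norm \<Phi>1 \<Phi>2 = a powr (- 1 / 2)" if "a - b \<ge> 1" "b = 0"
  proof (cases "a = 1")
    case True
    then show ?thesis using degenerate that by simp
  next
    case False
    then have "a > 1" using that by simp
    moreover have "(1 / a\<^sup>2) powr (1 / 4) = a powr (- 1 / 2)"
      using \<open>a > 1\<close> by (simp add: powr_divide powr_minus_divide powr_powr flip: powr_numeral)
    ultimately show ?thesis using stationary(2)[of 0] that by simp
  qed
  moreover have "let \<gamma> = 1 / (2 * b) * (1 - a\<^sup>2 + b\<^sup>2 + sqrt ((a\<^sup>2 - b\<^sup>2 - 1)\<^sup>2 - 4 * b\<^sup>2))
         in embedding_norm \<Phi>1 \<Phi>2 = ((1 - \<gamma>\<^sup>2) / (a\<^sup>2 - (b - \<gamma>)\<^sup>2)) powr (1 / 4)"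
    if "a - b > 1" "b > 0"
    unfolding Let_def using stationary(2)[OF that(1)] stationary_exponent[OF that(2,1)] by blast
  ultimately show ?thesis
    using weights_le_iff degenerate by blast
qed

end
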